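(* Let $(\Omega,\mathcal F,\mathsf P)$ be a probability space, let $p\in(0,1)$, and let $B_1,B_2,\dots$ be an infinite sequence of independent events in $\mathcal F$ such that $\mathsf P(B_i)=p$ for all $i\in\mathbb N=\{1,2,\dots\}$. Suppose that $A\in\mathcal F$ is an event such that, for some $q\in(0,1)$, $\mathsf P(A\mid B_i)=q$ for all $i\in\mathbb N$. Then, for each $i\in\mathbb N$, the event $A$ is independent of the event $B_i$.
   Context: An event is a member of the $\sigma$-algebra $\mathcal F$. Independence of the sequence $(B_i)_{i\in\mathbb N}$ means mutual independence. $\mathsf P(A\mid B)=\mathsf P(A\cap B)/\mathsf P(B)$ for events $A,B$ with $\mathsf P(B)>0$. *)

theory Defs
  imports "HOL-Probability.Probability"
begin

end

theory Submission
  imports Defs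
begin

text \<open>
  The covariances \<open>P(A \<inter> B\<^sub>i) - P(A) P(B\<^sub>i)\<close> are the inner products in \<open>L\<^sup>2\<close> of the centred
  indicator of \<open>A\<close> with the centred indicators of the \<open>B\<^sub>i\<close>. Independence makes the latter an
  orthogonal system of vectors of norm at most 1, so by Bessel's inequality
  (\<open>Bessel_inequality_integral\<close>) the squares of these covariances have a finite sum, whatever
  the event \<open>A\<close> is (\<open>sum_squared_event_covariance_le_1\<close>). Under the hypotheses every covariance has
  the same value \<open>p * (q - P(A))\<close>. Infinitely many copies of a positive number cannot have a
  finite sum, so this value is 0, and that is independence of \<open>A\<close> and \<open>B\<^sub>i\<close>.
\<close>

text \<open>
  The integral of \<open>(g - (\<Sum>i\<in>I. c i * f i))\<^sup>2\<close> is nonnegative; the coefficients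
  \<open>c i = \<integral>g * f i\<close> are those of the orthogonal projection when the \<open>f i\<close> have norm 1, and for
  shorter vectors they still give the inequality.
\<close>

lemma Bessel_inequality_integral:
  fixes f :: "'i \<Rightarrow> 'a \<Rightarrow> real" and g :: "'a \<Rightarrow> real"
  assumes "finite I"
    and int_gg: "integrable M (\<lambda>x. g x * g x)"
    and int_gf: "\<And>i. i \<in> I \<Longrightarrow> integrable M (\<lambda>x. g x * f i x)"
    and int_ff: "\<And>i j. i \<in> I \<Longrightarrow> j \<in> I \<Longrightarrow> integrable M (\<lambda>x. f i x * f j x)"
    and orthogonal: "\<And>i j. i \<in> I \<Longrightarrow> j \<in> I \<Longrightarrow> i \<noteq> j \<Longrightarrow> (\<integral>x. f i x * f j x \<partial>M) = 0"
    and norm_le_1: "\<And>i. i \<in> I \<Longrightarrow> (\<integral>x. f i x * f i x \<partial>M) \<le> 1"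
  shows "(\<Sum>i\<in>I. (\<integral>x. g x * f i x \<partial>M)\<^sup>2) \<le> (\<integral>x. g x * g x \<partial>M)"
proof -
  define c where "c i = (\<integral>x. g x * f i x \<partial>M)" for i
  have expand: "(g x - (\<Sum>i\<in>I. c i * f i x))\<^sup>2 =
      g x * g x - 2 * (\<Sum>i\<in>I. c i * (g x * f i x)) + (\<Sum>i\<in>I. \<Sum>j\<in>I. c i * c j * (f i x * f j x))"
    for x
  proof -
    have "(\<Sum>i\<in>I. c i * f i x)\<^sup>2 = (\<Sum>i\<in>I. \<Sum>j\<in>I. c i * c j * (f i x * f j x))"
      by (simp add: power2_eq_square sum_product mult_ac)
    moreover have "g x * (\<Sum>i\<in>I. c i * f i x) = (\<Sum>i\<in>I. c i * (g x * f i x))"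
      by (simp add: sum_distrib_left mult_ac)
    ultimately show ?thesis
      by (simp add: power2_diff power2_eq_square[of "g x"])
  qed
  have "(\<Sum>j\<in>I. c i * c j * (\<integral>x. f i x * f j x \<partial>M)) = c i * c i * (\<integral>x. f i x * f i x \<partial>M)"
    if "i \<in> I" for i
  proof -
    have "(\<Sum>j\<in>I - {i}. c i * c j * (\<integral>x. f i x * f j x \<partial>M)) = 0"
      using orthogonal[OF that] by (intro sum.neutral) force
    then show ?thesis
      by (simp add: sum.remove[OF \<open>finite I\<close> that])
  qed
  moreover have "c i * c i * (\<integral>x. f i x * f i x \<partial>M) \<le> (c i)\<^sup>2" if "i \<in> I" for i
    using mult_left_mono[OF norm_le_1[OF that], of "(c i)\<^sup>2"] by (simp add: power2_eq_square)
  ultimately have diagonal: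
    "(\<Sum>i\<in>I. \<Sum>j\<in>I. c i * c j * (\<integral>x. f i x * f j x \<partial>M)) \<le> (\<Sum>i\<in>I. (c i)\<^sup>2)"
    by (intro sum_mono) simp
  have "0 \<le> (\<integral>x. (g x - (\<Sum>i\<in>I. c i * f i x))\<^sup>2 \<partial>M)"
    by simp
  also have "\<dots> = (\<integral>x. g x * g x \<partial>M) - 2 * (\<Sum>i\<in>I. c i * (\<integral>x. g x * f i x \<partial>M))
      + (\<Sum>i\<in>I. \<Sum>j\<in>I. c i * c j * (\<integral>x. f i x * f j x \<partial>M))"
    unfolding expand using int_gg int_gf int_ff
    by simp
  also have "\<dots> \<le> (\<integral>x. g x * g x \<partial>M) - (\<Sum>i\<in>I. (c i)\<^sup>2)"
    using diagonal unfolding c_def[symmetric] power2_eq_square by linarith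
  finally show ?thesis
    by (simp add: c_def)
qed

context prob_space
begin

lemma centred_indicator_mult_eq:
  "(indicator A x - a) * (indicator B x - b) =
    indicator (A \<inter> B) x - b * indicator A x - a * indicator B x + (a * b :: real)"
  by (simp add: indicator_inter_arith algebra_simps)

lemma integrable_centred_indicator_mult:
  assumes "A \<in> events" "B \<in> events"
  shows "integrable M (\<lambda>x. (indicator A x - prob A) * (indicator B x - prob B) :: real)"
  using assms by (simp add: centred_indicator_mult_eq emeasure_eq_measure)

lemma expectation_centred_indicator_mult:
  assumes "A \<in> events" "B \<in> events"
  shows "expectation (\<lambda>x. (indicator A x - prob A) * (indicator B x - prob B))
    = prob (A \<inter> B) - prob A * prob B"
  using assms sets.sets_into_space[of A M] sets.sets_into_space[of B M]
  by (simp add: centred_indicator_mult_eq emeasure_eq_measure prob_space Int_absorb2 le_infI1)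

text \<open>
  Bessel's inequality for the centred indicators, whose inner products are the covariances. The
  bound does not depend on \<open>I\<close>, so over an infinite family the covariances must tend to 0.
\<close>

lemma sum_squared_event_covariance_le_1:
  assumes "finite I" and A: "A \<in> events" and B: "\<And>i. i \<in> I \<Longrightarrow> B i \<in> events"
    and pairwise_indep:
      "\<And>i j. i \<in> I \<Longrightarrow> j \<in> I \<Longrightarrow> i \<noteq> j \<Longrightarrow> prob (B i \<inter> B j) = prob (B i) * prob (B j)"
  shows "(\<Sum>i\<in>I. (prob (A \<inter> B i) - prob A * prob (B i))\<^sup>2) \<le> 1"
proof -
  have le_1: "prob C - prob C * prob C \<le> 1" for C
    using prob_le_1[of C] zero_le_mult_iff[of "prob C" "prob C"] by linarith
  have "(\<Sum>i\<in>I. (prob (A \<inter> B i) - prob A * prob (B i))\<^sup>2) =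
      (\<Sum>i\<in>I. (expectation (\<lambda>x. (indicator A x - prob A) * (indicator (B i) x - prob (B i))))\<^sup>2)"
    using A B by (simp add: expectation_centred_indicator_mult)
  also have "\<dots> \<le> expectation (\<lambda>x. (indicator A x - prob A) * (indicator A x - prob A))"
    using A B le_1 pairwise_indep \<open>finite I\<close>
    by (intro Bessel_inequality_integral)
      (simp_all add: integrable_centred_indicator_mult expectation_centred_indicator_mult)
  also have "\<dots> \<le> 1"
    using A le_1 by (simp add: expectation_centred_indicator_mult)
  finally show ?thesis .
qed

lemma indep_eventI:
  assumes "A \<in> events" "B \<in> events" "prob (A \<inter> B) = prob A * prob B"
  shows "indep_event A B"
  unfolding indep_event_def
proof (rule indep_eventsI)
  fix J :: "bool set" assume "J \<noteq> {}"
  moreover have "J \<in> Pow {True, False}"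
    by auto
  ultimately have "J = {True} \<or> J = {False} \<or> J = {True, False}"
    by (simp only: Pow_insert Pow_empty) auto
  then show "prob (\<Inter>i\<in>J. case_bool A B i) = (\<Prod>i\<in>J. prob (case_bool A B i))"
    using assms(3) by auto
qed (use assms in \<open>simp split: bool.split\<close>)

end

theorem theorem1:
  fixes M :: "'a measure"
    and p q :: real
    and B :: "nat \<Rightarrow> 'a set"
    and A :: "'a set"
  assumes "prob_space M"
    and "0 < p" and "p < 1"
    and "\<And>i. i \<ge> 1 \<Longrightarrow> B i \<in> sets M"
    and "prob_space.indep_events M B {1..}"
    and "\<And>i. i \<ge> 1 \<Longrightarrow> measure M (B i) = p"
    and "A \<in> sets M"
    and "0 < q" and "q < 1"
    and "\<And>i. i \<ge> 1 \<Longrightarrow> \<P>(\<omega> in M. \<omega> \<in> A \<bar> \<omega> \<in> B i) = q"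
  shows "\<forall>i\<ge>1. prob_space.indep_event M A (B i)"
proof -
  interpret prob_space M by fact
  have prob_Int: "prob (A \<inter> B i) = p * q" if "i \<ge> 1" for i
  proof -
    have "{\<omega> \<in> space M. \<omega> \<in> A \<and> \<omega> \<in> B i} = A \<inter> B i" "{\<omega> \<in> space M. \<omega> \<in> B i} = B i"
      using sets.sets_into_space assms(4)[OF that] by blast+
    then show ?thesis
      using assms(10)[OF that] assms(6)[OF that] \<open>0 < p\<close> by (simp add: cond_prob_def field_simps)
  qed
  have pairwise: "prob (B i \<inter> B j) = prob (B i) * prob (B j)"
    if "i \<ge> 1" "j \<ge> 1" "i \<noteq> j" for i j
  proof -
    have "prob (\<Inter>k\<in>{i, j}. B k) = (\<Prod>k\<in>{i, j}. prob (B k))"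
      using that
      by (intro assms(5)[unfolded indep_events_def, THEN conjunct2, rule_format]) simp_all
    then show ?thesis using that by simp
  qed
  \<comment> \<open>The common value of all the covariances of \<open>A\<close> and \<open>B i\<close>.\<close>
  define d where "d = p * q - prob A * p"
  have bound: "real n * d\<^sup>2 \<le> 1" for n
  proof -
    have "(\<Sum>i\<in>{1..n}. (prob (A \<inter> B i) - prob A * prob (B i))\<^sup>2) \<le> 1"
      using assms(4,7) pairwise by (intro sum_squared_event_covariance_le_1) auto
    then show ?thesis by (simp add: prob_Int assms(6) d_def)
  qed
  have "d = 0"
  proof (rule ccontr)
    assume "d \<noteq> 0"
    then obtain n where "1 < real n * d\<^sup>2"
      using reals_Archimedean3[of "d\<^sup>2"] by auto
    with bound[of n] show False by simp
  qed
  then show ?thesis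
    using assms(4,6,7) prob_Int by (auto intro!: indep_eventI simp: d_def)
qed

end
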